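(* Let $d\ge 2$ and let $T$ be an $AG$-quasiregular $d$-simplex in a $d$-dimensional Minkowski space $(\mathbb{R}^d,\|\cdot\|)$. Then the centroid $G$ of $T$ coincides with a circumcenter $M$ of $T$ and with the Monge point $N_M$, the Feuerbach center $F_M$ and the complementary point $P_M$ associated to $M$, i.e. the associated Euler line collapses to a single point. In particular, $G$ is both a circumcenter of $T$ and the center of a Minkowskian sphere through the centroids of the facets of $T$ (the Feuerbach sphere). Moreover, $AG$-quasiregular $d$-simplices are the only $d$-simplices having the property that one associated Euler line collapses: if a $d$-simplex $T$ has a circumcenter $M$ for which the points $M, G, F_M, N_M, P_M$ all coincide, then $T$ is $AG$-quasiregular.
   Context: A Minkowski space is $\mathbb{R}^d$ equipped with an arbitrary norm $\|\cdot\|$. A circumcenter of a $d$-simplex $T$ is the center of a Minkowskian sphere $\{Y:\|Y-M\|=r\}$ ($r>0$) containing all vertices of $T$. For $T$ with vertices $A_0,\dots,A_d$, the centroid is $G=\frac{1}{d+1}\sum_{i=0}^d A_i$, and $A_i'=\frac1d\sum_{j\ne i}A_j$ is the centroid of the facet opposite $A_i$. $T$ is called $AG$-quasiregular if its centroid is a circumcenter of $T$. Let $M$ be a circumcenter of $T$. The complementary point $P_M$ associated to $M$ is the common point of the lines through a vertex $A_i$ parallel to the line through $A_i'$ and $M$ (for those $i$ with $A_i'\neq M$); explicitly $P_M=\sum_{i=0}^d A_i-dM$. The Monge point $N_M$ associated to $M$ is the common point of the lines through the centroid of a $(d-2)$-face of $T$ parallel to the line through $M$ and the midpoint of the opposite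 edge (whenever that midpoint differs from $M$); explicitly $N_M=\frac{1}{d-1}\left(\sum_{i=0}^d A_i-2M\right)$. The Feuerbach center $F_M$ associated to $M$ divides the segment $[MP_M]$ internally in the ratio $1:(d-1)$, i.e. $F_M=M+\frac1d(P_M-M)$. The Euler line associated to $M$ is the line containing $M,G,F_M,N_M,P_M$; it is said to collapse if all these points coincide. *)

theory Defs
  imports "HOL-Analysis.Analysis"
begin

text \<open>
  A Minkowski space is the vector space \<open>real ^ 'd\<close> (of dimension \<open>d = CARD('d)\<close>) together with an
  arbitrary norm \<open>nrm\<close>, passed explicitly because the type-class norm on \<open>real ^ 'd\<close> is the
  Euclidean one.
\<close>

definition minkowski_norm :: "(real ^ 'd \<Rightarrow> real) \<Rightarrow> bool" where
  "minkowski_norm nrm \<longleftrightarrow>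
     (\<forall>x. 0 \<le> nrm x) \<and>
     (\<forall>x. nrm x = 0 \<longleftrightarrow> x = 0) \<and>
     (\<forall>c x. nrm (c *\<^sub>R x) = \<bar>c\<bar> * nrm x) \<and>
     (\<forall>x y. nrm (x + y) \<le> nrm x + nrm y)"

definition minkowski_sphere :: "(real ^ 'd \<Rightarrow> real) \<Rightarrow> real ^ 'd \<Rightarrow> real \<Rightarrow> (real ^ 'd) set" where
  "minkowski_sphere nrm M r = {Y. nrm (Y - M) = r}"

definition vertices :: "(real ^ 'd) set \<Rightarrow> (real ^ 'd) set" where
  "vertices T = {v. v extreme_point_of T}"

definition circumcenter :: "(real ^ 'd \<Rightarrow> real) \<Rightarrow> (real ^ 'd) set \<Rightarrow> real ^ 'd \<Rightarrow> bool" where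
  "circumcenter nrm T M \<longleftrightarrow> (\<exists>r>0. vertices T \<subseteq> minkowski_sphere nrm M r)"

definition mean_point :: "(real ^ 'd) set \<Rightarrow> real ^ 'd" where
  "mean_point V = (1 / real (card V)) *\<^sub>R (\<Sum>v\<in>V. v)"

definition centroid :: "(real ^ 'd) set \<Rightarrow> real ^ 'd" where
  "centroid T = mean_point (vertices T)"

definition facet_centroid :: "(real ^ 'd) set \<Rightarrow> real ^ 'd \<Rightarrow> real ^ 'd" where
  "facet_centroid T v = mean_point (vertices T - {v})"

text \<open>The centroid of the \<open>(d - 2)\<close>-face opposite to the edge with endpoints \<open>v\<close> and \<open>w\<close>:\<close>

definition ridge_centroid :: "(real ^ 'd) set \<Rightarrow> real ^ 'd \<Rightarrow> real ^ 'd \<Rightarrow> real ^ 'd" where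
  "ridge_centroid T v w = mean_point (vertices T - {v, w})"

definition AG_quasiregular :: "(real ^ 'd \<Rightarrow> real) \<Rightarrow> (real ^ 'd) set \<Rightarrow> bool" where
  "AG_quasiregular nrm T \<longleftrightarrow> circumcenter nrm T (centroid T)"

text \<open>The line through \<open>X\<close> parallel to the line through \<open>Y\<close> and \<open>Z\<close>; used only for \<open>Y \<noteq> Z\<close>:\<close>

definition parallel_line :: "real ^ 'd \<Rightarrow> real ^ 'd \<Rightarrow> real ^ 'd \<Rightarrow> (real ^ 'd) set" where
  "parallel_line X Y Z = range (\<lambda>t. X + t *\<^sub>R (Z - Y))"

text \<open>
  The next two points are defined as common points of families of lines. For a \<open>d\<close>-simplex with
  \<open>d \<ge> 2\<close> existence, uniqueness and the explicit formulas are proved below.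
\<close>

definition complementary_point :: "(real ^ 'd) set \<Rightarrow> real ^ 'd \<Rightarrow> real ^ 'd" where
  "complementary_point T M =
     (THE P. \<forall>v \<in> vertices T. facet_centroid T v \<noteq> M \<longrightarrow>
               P \<in> parallel_line v (facet_centroid T v) M)"

definition monge_point :: "(real ^ 'd) set \<Rightarrow> real ^ 'd \<Rightarrow> real ^ 'd" where
  "monge_point T M =
     (THE N. \<forall>v \<in> vertices T. \<forall>w \<in> vertices T. v \<noteq> w \<longrightarrow> midpoint v w \<noteq> M \<longrightarrow>
               N \<in> parallel_line (ridge_centroid T v w) M (midpoint v w))"

text \<open>The point dividing the segment from \<open>M\<close> to \<open>P\<^sub>M\<close> internally in the ratio \<open>1 : (d - 1)\<close>:\<close>

definition feuerbach_center :: "(real ^ 'd) set \<Rightarrow> real ^ 'd \<Rightarrow> real ^ 'd" where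
  "feuerbach_center T M = M + (1 / real CARD('d)) *\<^sub>R (complementary_point T M - M)"

definition euler_points :: "(real ^ 'd) set \<Rightarrow> real ^ 'd \<Rightarrow> (real ^ 'd) set" where
  "euler_points T M =
     {M, centroid T, feuerbach_center T M, monge_point T M, complementary_point T M}"

definition euler_line :: "(real ^ 'd) set \<Rightarrow> real ^ 'd \<Rightarrow> (real ^ 'd) set" where
  "euler_line T M = affine hull (euler_points T M)"

definition euler_line_collapses :: "(real ^ 'd) set \<Rightarrow> real ^ 'd \<Rightarrow> bool" where
  "euler_line_collapses T M \<longleftrightarrow> (\<exists>X. euler_points T M = {X})"


lemma simplex_vertices:
  assumes "int CARD('d) simplex (T :: (real ^ 'd) set)"
  shows "finite (vertices T)" "card (vertices T) = CARD('d) + 1"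
    "\<not> affine_dependent (vertices T)" "T = convex hull vertices T"
proof -
  obtain C where C: "\<not> affine_dependent C" "int (card C) = int CARD('d) + 1" "T = convex hull C"
    using assms unfolding simplex_def by blast
  have "vertices T = C"
    unfolding vertices_def using C by (simp add: extreme_point_of_convex_hull_affine_independent)
  with C show "finite (vertices T)" "card (vertices T) = CARD('d) + 1"
    "\<not> affine_dependent (vertices T)" "T = convex hull vertices T"
    by (auto intro: aff_independent_finite)
qed

lemma simplex_three_vertices:
  assumes "int CARD('d) simplex (T :: (real ^ 'd) set)" "CARD('d) \<ge> 2"
  obtains a b c where "{a, b, c} \<subseteq> vertices T" "a \<noteq> b" "a \<noteq> c" "b \<noteq> c" "\<not> collinear {a, b, c}"
proof -
  note V = simplex_vertices[OF assms(1)]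
  have "3 \<le> card (vertices T)" using V(2) assms(2) by simp
  then obtain S where S: "S \<subseteq> vertices T" "card S = 3"
    by (meson obtain_subset_with_card_n)
  then obtain a b c where abc: "S = {a, b, c}" "a \<noteq> b" "a \<noteq> c" "b \<noteq> c"
    by (auto simp: card_3_iff)
  have "\<not> affine_dependent {a, b, c}"
    using V(3) S abc affine_dependent_subset by blast
  then have "\<not> collinear {a, b, c}"
    using abc by (simp add: collinear_3_eq_affine_dependent)
  with that S abc show thesis by blast
qed

lemma concurrent_lines_unique:
  fixes a b c :: "'a :: real_vector" and A B C D M :: 'a
  assumes nc: "\<not> collinear {a, b, c}"
    and k: "k \<noteq> 0" "A - B = k *\<^sub>R (a - b)" "A - C = k *\<^sub>R (a - c)"
    and D: "\<And>X. X \<in> {A, B, C} \<Longrightarrow> X \<noteq> M \<Longrightarrow> \<exists>t. D = t *\<^sub>R (X - M)"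
  shows "D = 0"
proof (rule ccontr)
  assume "D \<noteq> 0"
  have *: "\<exists>s. X = M + s *\<^sub>R D" if X: "X \<in> {A, B, C}" for X
  proof (cases "X = M")
    case True
    then have "X = M + 0 *\<^sub>R D" by simp
    then show ?thesis by blast
  next
    case False
    then obtain t where t: "D = t *\<^sub>R (X - M)" using D[OF X False] by auto
    with \<open>D \<noteq> 0\<close> have "t \<noteq> 0" by (metis scaleR_zero_left)
    then have "X = M + (1 / t) *\<^sub>R D" by (simp add: t)
    then show ?thesis by blast
  qed
  obtain p q r where pqr: "A = M + p *\<^sub>R D" "B = M + q *\<^sub>R D" "C = M + r *\<^sub>R D"
    using *[of A] *[of B] *[of C] by auto
  have *: "\<exists>t. x = a + t *\<^sub>R D" if x: "(s - p) *\<^sub>R D = k *\<^sub>R (x - a)" for s x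
  proof -
    have "x - a = (1 / k) *\<^sub>R (k *\<^sub>R (x - a))" using k(1) by simp
    also have "\<dots> = ((s - p) / k) *\<^sub>R D" by (simp add: x[symmetric])
    finally have "x = a + ((s - p) / k) *\<^sub>R D" by (metis add.commute diff_add_cancel)
    then show ?thesis by blast
  qed
  have b: "\<exists>t. b = a + t *\<^sub>R D"
    by (rule *[of q]) (use k(2) pqr in \<open>simp add: algebra_simps\<close>)
  have c: "\<exists>t. c = a + t *\<^sub>R D"
    by (rule *[of r]) (use k(3) pqr in \<open>simp add: algebra_simps\<close>)
  have a: "a = a + 0 *\<^sub>R D" by simp
  have "collinear {a, b, c}"
    unfolding collinear_alt using a b c by (intro exI[of _ a] exI[of _ D]) blast
  with nc show False ..
qed

lemma facet_centroid_eq: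
  assumes "int CARD('d) simplex (T :: (real ^ 'd) set)" "v \<in> vertices T"
  shows "facet_centroid T v = (1 / real CARD('d)) *\<^sub>R (\<Sum>(vertices T) - v)"
  using simplex_vertices[OF assms(1)] assms(2)
  by (simp add: facet_centroid_def mean_point_def sum_diff1)

lemma ridge_centroid_eq:
  assumes "int CARD('d) simplex (T :: (real ^ 'd) set)"
    and "v \<in> vertices T" "w \<in> vertices T" "v \<noteq> w"
  shows "ridge_centroid T v w = (1 / (real CARD('d) - 1)) *\<^sub>R (\<Sum>(vertices T) - v - w)"
proof -
  note V = simplex_vertices[OF assms(1)]
  have "card (vertices T - {v, w}) = CARD('d) - 1"
    using V assms by (subst card_Diff_subset) auto
  moreover have "real (CARD('d) - 1) = real CARD('d) - 1"
    by (simp add: of_nat_diff Suc_leI)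
  moreover have "(\<Sum>x\<in>vertices T - {v, w}. x) = \<Sum>(vertices T) - v - w"
    using V assms by (subst sum_diff) auto
  ultimately show ?thesis by (simp add: ridge_centroid_def mean_point_def)
qed

lemma complementary_point_ex1:
  fixes T :: "(real ^ 'd) set" and M :: "real ^ 'd"
  assumes T: "int CARD('d) simplex T" "CARD('d) \<ge> 2"
  defines "Q \<equiv> \<Sum>(vertices T) - real CARD('d) *\<^sub>R M"
  defines "\<Phi> \<equiv> \<lambda>P. \<forall>v \<in> vertices T. facet_centroid T v \<noteq> M \<longrightarrow>
                    P \<in> parallel_line v (facet_centroid T v) M"
  shows "\<Phi> Q" "\<And>P. \<Phi> P \<Longrightarrow> P = Q"
proof -
  let ?d = "real CARD('d)"
  have Q: "Q = v + (- ?d) *\<^sub>R (M - facet_centroid T v)" if "v \<in> vertices T" for v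
  proof -
    have "?d *\<^sub>R facet_centroid T v = \<Sum>(vertices T) - v"
      by (simp add: facet_centroid_eq[OF T(1) that])
    then show ?thesis by (simp add: Q_def scaleR_diff_right)
  qed
  then show "\<Phi> Q" unfolding \<Phi>_def parallel_line_def by blast
  fix P assume P: "\<Phi> P"
  obtain a b c where abc: "{a, b, c} \<subseteq> vertices T" "\<not> collinear {a, b, c}"
    using simplex_three_vertices[OF T] by metis
  have "P - Q = 0"
  proof (rule concurrent_lines_unique[OF abc(2), where k = "- (1 / ?d)" and M = M
      and A = "facet_centroid T a" and B = "facet_centroid T b" and C = "facet_centroid T c"])
    show "facet_centroid T a - facet_centroid T b = - (1 / ?d) *\<^sub>R (a - b)"
      "facet_centroid T a - facet_centroid T c = - (1 / ?d) *\<^sub>R (a - c)"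
      using abc(1) by (simp_all add: facet_centroid_eq[OF T(1)] algebra_simps)
    fix X assume "X \<in> {facet_centroid T a, facet_centroid T b, facet_centroid T c}" "X \<noteq> M"
    then obtain v where v: "v \<in> vertices T" "X = facet_centroid T v" using abc(1) by blast
    then obtain t where "P = v + t *\<^sub>R (M - X)"
      using P \<open>X \<noteq> M\<close> unfolding \<Phi>_def parallel_line_def by blast
    moreover have "Q = v + (- ?d) *\<^sub>R (M - X)" using Q[OF v(1)] v(2) by simp
    ultimately have "P - Q = (t + ?d) *\<^sub>R (M - X)"
      by (simp add: scaleR_add_left)
    also have "\<dots> = (- t - ?d) *\<^sub>R (X - M)" by (simp add: algebra_simps)
    finally have "P - Q = (- t - ?d) *\<^sub>R (X - M)" .
    then show "\<exists>t. P - Q = t *\<^sub>R (X - M)" by blast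
  qed simp
  then show "P = Q" by simp
qed

lemma complementary_point_eq:
  fixes T :: "(real ^ 'd) set" and M :: "real ^ 'd"
  assumes "int CARD('d) simplex T" "CARD('d) \<ge> 2"
  shows "complementary_point T M = \<Sum>(vertices T) - real CARD('d) *\<^sub>R M"
  unfolding complementary_point_def
  using complementary_point_ex1[OF assms] by (rule the_equality)

lemma monge_point_ex1:
  fixes T :: "(real ^ 'd) set" and M :: "real ^ 'd"
  assumes T: "int CARD('d) simplex T" "CARD('d) \<ge> 2"
  defines "Q \<equiv> (1 / (real CARD('d) - 1)) *\<^sub>R (\<Sum>(vertices T) - 2 *\<^sub>R M)"
  defines "\<Phi> \<equiv> \<lambda>N. \<forall>v \<in> vertices T. \<forall>w \<in> vertices T. v \<noteq> w \<longrightarrow> midpoint v w \<noteq> M \<longrightarrow>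
                    N \<in> parallel_line (ridge_centroid T v w) M (midpoint v w)"
  shows "\<Phi> Q" "\<And>N. \<Phi> N \<Longrightarrow> N = Q"
proof -
  let ?e = "1 / (real CARD('d) - 1)"
  have Q: "Q = ridge_centroid T v w + (2 * ?e) *\<^sub>R (midpoint v w - M)"
    if "v \<in> vertices T" "w \<in> vertices T" "v \<noteq> w" for v w
  proof -
    have "(2 * ?e) *\<^sub>R (midpoint v w - M) = ?e *\<^sub>R (v + w - 2 *\<^sub>R M)"
      by (simp add: midpoint_def algebra_simps)
    then show ?thesis
      unfolding ridge_centroid_eq[OF T(1) that] Q_def
      by (simp only: scaleR_add_right[symmetric]) (simp add: algebra_simps)
  qed
  then show "\<Phi> Q" unfolding \<Phi>_def parallel_line_def by blast
  fix N assume N: "\<Phi> N"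
  obtain a b c where abc: "{a, b, c} \<subseteq> vertices T" "\<not> collinear {a, b, c}"
    "a \<noteq> b" "a \<noteq> c" "b \<noteq> c"
    using simplex_three_vertices[OF T] by metis
  have "N - Q = 0"
  proof (rule concurrent_lines_unique[OF abc(2), where k = "- (1 / 2)" and M = M
      and A = "midpoint b c" and B = "midpoint a c" and C = "midpoint a b"])
    show "midpoint b c - midpoint a c = - (1 / 2) *\<^sub>R (a - b)"
      "midpoint b c - midpoint a b = - (1 / 2) *\<^sub>R (a - c)"
      by (simp_all add: midpoint_def algebra_simps)
    fix X assume "X \<in> {midpoint b c, midpoint a c, midpoint a b}" "X \<noteq> M"
    then obtain v w where v: "v \<in> vertices T" "w \<in> vertices T" "v \<noteq> w" "X = midpoint v w"
      using abc by blast
    then obtain t where "N = ridge_centroid T v w + t *\<^sub>R (X - M)"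
      using N \<open>X \<noteq> M\<close> unfolding \<Phi>_def parallel_line_def by blast
    then have "N - Q = (t - 2 * ?e) *\<^sub>R (X - M)"
      using Q[OF v(1-3)] v(4) by (simp add: scaleR_diff_left)
    then show "\<exists>t. N - Q = t *\<^sub>R (X - M)" by blast
  qed simp
  then show "N = Q" by simp
qed

lemma monge_point_eq:
  fixes T :: "(real ^ 'd) set" and M :: "real ^ 'd"
  assumes "int CARD('d) simplex T" "CARD('d) \<ge> 2"
  shows "monge_point T M = (1 / (real CARD('d) - 1)) *\<^sub>R (\<Sum>(vertices T) - 2 *\<^sub>R M)"
  unfolding monge_point_def
  using monge_point_ex1[OF assms] by (rule the_equality)

end

theory Submission
  imports Defs
begin

text \<open>
  The vertices sum to \<open>(d + 1) G\<close>, so for \<open>M = G\<close> the formulas for the complementary and the Monge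
  point both evaluate to \<open>G\<close>. The Feuerbach sphere is the image of the circumsphere under the
  homothety with center \<open>G\<close> and ratio \<open>- 1 / d\<close>, which maps each vertex to the centroid of the
  opposite facet.
\<close>

text \<open>The explicit formulas for the associated points and facet centroids involve the vertex
  sum; this turns them into expressions in the centroid. A \<open>d\<close>-simplex has
  \<open>d + 1\<close> vertices, whence the factor.\<close>

lemma sum_vertices:
  assumes "int CARD('d) simplex (T :: (real ^ 'd) set)"
  shows "\<Sum>(vertices T) = (real CARD('d) + 1) *\<^sub>R centroid T"
  using simplex_vertices(2)[OF assms] by (simp add: centroid_def mean_point_def add.commute)

text \<open>The coefficients of \<open>centroid T\<close> add up to
  \<open>(d + 1) - d = 1\<close>.\<close>

lemma complementary_point_centroid:
  fixes T :: "(real ^ 'd) set"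
  assumes "int CARD('d) simplex T" "CARD('d) \<ge> 2"
  shows "complementary_point T (centroid T) = centroid T"
  by (simp add: complementary_point_eq[OF assms] sum_vertices[OF assms(1)] scaleR_add_left)

lemma monge_point_centroid:
  fixes T :: "(real ^ 'd) set"
  assumes "int CARD('d) simplex T" "CARD('d) \<ge> 2"
  shows "monge_point T (centroid T) = centroid T"
proof -
  \<comment> \<open>The factor \<open>(d + 1) - 2 = d - 1\<close> is the denominator in the Monge
    point formula; it cancels because \<open>d\<close> is at least 2.\<close>
  have "\<Sum>(vertices T) - 2 *\<^sub>R centroid T = (real CARD('d) - 1) *\<^sub>R centroid T"
    by (simp add: sum_vertices[OF assms(1)] scaleR_left_diff_distrib[symmetric])
  then show ?thesis
    using assms(2) by (simp add: monge_point_eq[OF assms])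
qed

text \<open>The segment from \<open>M\<close> to the complementary point degenerates to a point, so
  dividing it in any ratio returns \<open>M\<close>.\<close>

lemma feuerbach_center_centroid:
  fixes T :: "(real ^ 'd) set"
  assumes "int CARD('d) simplex T" "CARD('d) \<ge> 2"
  shows "feuerbach_center T (centroid T) = centroid T"
  by (simp add: feuerbach_center_def complementary_point_centroid[OF assms])

lemma euler_points_centroid:
  fixes T :: "(real ^ 'd) set"
  assumes "int CARD('d) simplex T" "CARD('d) \<ge> 2"
  shows "euler_points T (centroid T) = {centroid T}"
  by (simp add: euler_points_def complementary_point_centroid[OF assms]
      monge_point_centroid[OF assms] feuerbach_center_centroid[OF assms])

lemma facet_centroid_diff_centroid:
  assumes "int CARD('d) simplex (T :: (real ^ 'd) set)" "v \<in> vertices T"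
  shows "facet_centroid T v - centroid T = (- 1 / real CARD('d)) *\<^sub>R (v - centroid T)"
proof -
  \<comment> \<open>Gives the centroid the same factor \<open>1 / d\<close> as the facet centroid,
    so that it can be pulled out of the difference.\<close>
  have "centroid T = (1 / real CARD('d)) *\<^sub>R (real CARD('d) *\<^sub>R centroid T)"
    by simp
  then have "facet_centroid T v - centroid T =
      (1 / real CARD('d)) *\<^sub>R (\<Sum>(vertices T) - v - real CARD('d) *\<^sub>R centroid T)"
    by (metis facet_centroid_eq[OF assms] scaleR_diff_right)
  also have "\<Sum>(vertices T) - v - real CARD('d) *\<^sub>R centroid T = - (v - centroid T)"
    by (simp add: sum_vertices[OF assms(1)] scaleR_add_left)
  finally show ?thesis by (simp add: scaleR_diff_right)
qed

lemma feuerbach_sphere: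
  fixes T :: "(real ^ 'd) set"
  assumes "minkowski_norm nrm" "int CARD('d) simplex T" "circumcenter nrm T (centroid T)"
  shows "\<exists>r>0. \<forall>v \<in> vertices T. facet_centroid T v \<in> minkowski_sphere nrm (centroid T) r"
proof -
  obtain R where R: "R > 0" "\<And>v. v \<in> vertices T \<Longrightarrow> nrm (v - centroid T) = R"
    using assms(3) unfolding circumcenter_def minkowski_sphere_def by blast
  \<comment> \<open>Absolute homogeneity of the norm discards the sign of the ratio
    \<open>- 1 / d\<close>, so the new radius is the circumradius divided by
    \<open>d\<close>.\<close>
  have "nrm (facet_centroid T v - centroid T) = R / real CARD('d)" if "v \<in> vertices T" for v
  proof -
    have "nrm (c *\<^sub>R x) = \<bar>c\<bar> * nrm x" for c x
      using assms(1) unfolding minkowski_norm_def by blast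
    then show ?thesis
      by (simp only: facet_centroid_diff_centroid[OF assms(2) that] R(2)[OF that]) simp
  qed
  moreover have "R / real CARD('d) > 0"
    using R(1) by simp
  ultimately show ?thesis
    unfolding minkowski_sphere_def by blast
qed

theorem proposition3p1:
  fixes nrm :: "real ^ 'd \<Rightarrow> real" and T :: "(real ^ 'd) set"
  assumes "CARD('d) \<ge> 2"
    and "minkowski_norm nrm"
    and "int CARD('d) simplex T"
  shows "(AG_quasiregular nrm T \<longrightarrow>
           (\<exists>M. circumcenter nrm T M \<and>
                centroid T = M \<and>
                centroid T = monge_point T M \<and>
                centroid T = feuerbach_center T M \<and>
                centroid T = complementary_point T M \<and>
                euler_line_collapses T M \<and>
                euler_line T M = {centroid T}) \<and>
           circumcenter nrm T (centroid T) \<and>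
           (\<exists>r>0. \<forall>v \<in> vertices T. facet_centroid T v \<in> minkowski_sphere nrm (centroid T) r)) \<and>
         ((\<exists>M. circumcenter nrm T M \<and> euler_line_collapses T M) \<longrightarrow> AG_quasiregular nrm T)"
proof (intro conjI impI)
  assume "AG_quasiregular nrm T"
  then show circ: "circumcenter nrm T (centroid T)"
    by (simp add: AG_quasiregular_def)
  then show "\<exists>r>0. \<forall>v \<in> vertices T. facet_centroid T v \<in> minkowski_sphere nrm (centroid T) r"
    by (rule feuerbach_sphere[OF assms(2,3)])
  show "\<exists>M. circumcenter nrm T M \<and>
            centroid T = M \<and>
            centroid T = monge_point T M \<and>
            centroid T = feuerbach_center T M \<and>
            centroid T = complementary_point T M \<and>
            euler_line_collapses T M \<and>
            euler_line T M = {centroid T}"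
    using circ assms(1,3)
    by (intro exI[of _ "centroid T"])
      (simp add: monge_point_centroid feuerbach_center_centroid complementary_point_centroid
        euler_line_collapses_def euler_line_def euler_points_centroid)
next
  assume "\<exists>M. circumcenter nrm T M \<and> euler_line_collapses T M"
  then obtain M where M: "circumcenter nrm T M" "euler_line_collapses T M"
    by blast
  \<comment> \<open>Both \<open>M\<close> and \<open>centroid T\<close> belong to
    \<open>euler_points T M\<close>, so they agree once this set is a singleton.\<close>
  then have "centroid T = M"
    unfolding euler_line_collapses_def euler_points_def by blast
  with M(1) show "AG_quasiregular nrm T"
    by (simp add: AG_quasiregular_def)
qed

end
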